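(* For every sample $X_1,\ldots,X_n\in\mathbb{R}^p$ and every tolerance $\Delta>0$, the iterative algorithm described in the context converges after a finite number of iterations, i.e. its while-loop terminates after finitely many passes.
   Context: Let $X_1,\ldots,X_n\in\mathbb{R}^p$ be a fixed sample with $X_i\ne\pm X_j$ for $i\ne j$, and let $f_{P_n}(v)=\frac1n\sum_{i=1}^n(\|X_i-v\|\,\|X_i+v\|-\|X_i\|^2)$, with $\|\cdot\|$ the Euclidean norm. Update at non-sample points: for $v\ne\pm X_i$, $i=1,\ldots,n$, let $L(v)=\frac1n\sum_{i=1}^n\frac{\|v+X_i\|^2+\|v-X_i\|^2}{\|v-X_i\|\,\|v+X_i\|}$ and $T(v)=\frac{1}{L(v)}\frac1n\sum_{i=1}^n\frac{\|v+X_i\|^2-\|v-X_i\|^2}{\|v-X_i\|\,\|v+X_i\|}X_i$. Update at sample points: put $X_{-j}:=-X_j$ for $j=1,\ldots,n$, and for $k\in\{1,\ldots,n,-1,\ldots,-n\}$ let $\nabla f_k=\sum_{i\in\{1,\ldots,n,-1,\ldots,-n\},\,i\ne\pm k}\frac{\|X_i+X_k\|}{\|X_i-X_k\|}(X_i-X_k)$, and $d_k=-\nabla f_k/\|\nabla f_k\|$ when $\nabla f_k\neq0$. (One has $\nabla f_{-k}=-\nabla f_k$.) Let $M$ be the maximal non-zero value in $\{2\|X_1\|,\ldots,2\|X_n\|\}$. Define $T_k(X_k)=X_k$ if $\|\nabla f_k\|-2\|X_k\|\le 0$, and $T_k(X_k)=X_k-\varepsilon d_k$ if $\|\nabla f_k\|-2\|X_k\|>0$,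 where $0<\varepsilon<M$ is chosen (possibly depending on $k$) such that $f_{P_n}(T_k(X_k))<f_{P_n}(X_k)$; such an $\varepsilon$ exists. Algorithm, with input $X_1,\ldots,X_n$ and tolerance $\Delta>0$: initialize $v_{\mathrm{old}}$ as a unit-length leading eigenvector of $\frac1n\sum_{i=1}^n(X_i-\bar X)(X_i-\bar X)'$, $\bar X=\frac1n\sum_{i=1}^nX_i$, and $err\leftarrow\Delta+1$. While $err>\Delta$ do the following. If $v_{\mathrm{old}}\ne\pm X_i$ for all $i=1,\ldots,n$: set $v_{\mathrm{new}}\leftarrow T(v_{\mathrm{old}})$ and $err\leftarrow f_{P_n}(v_{\mathrm{old}})-f_{P_n}(v_{\mathrm{new}})$. Otherwise $v_{\mathrm{old}}=X_k$ for some $k\in\{\pm1,\ldots,\pm n\}$: set $v_{\mathrm{new}}\leftarrow T_k(v_{\mathrm{old}})$; if $\|\nabla f_k\|-2\|X_k\|\le0$ set $err\leftarrow f_{P_n}(v_{\mathrm{old}})-f_{P_n}(v_{\mathrm{new}})$, and if $\|\nabla f_k\|-2\|X_k\|>0$ set $err\leftarrow\Delta+1$. In all cases then set $v_{\mathrm{old}}\leftarrow v_{\mathrm{new}}$. (After the loop, the algorithm optionally rescales the length of $v_{\mathrm{new}}$ and returns it; the convergence statement concerns the while-loop.) *)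

theory Defs
  imports "HOL-Analysis.Analysis" "HOL-Library.While_Combinator"
begin

text \<open>The sample is \<open>X 1, \<dots>, X n\<close>; the values of \<open>X\<close> outside \<open>{1..n}\<close> are never used.\<close>

definition objective :: "(nat \<Rightarrow> real ^ 'p) \<Rightarrow> nat \<Rightarrow> real ^ 'p \<Rightarrow> real" where
  "objective X n v = (1 / real n) * (\<Sum>i=1..n. (norm (X i - v) * norm (X i + v) - (norm (X i))\<^sup>2))"

definition weight :: "(nat \<Rightarrow> real ^ 'p) \<Rightarrow> nat \<Rightarrow> real ^ 'p \<Rightarrow> real" where
  "weight X n v = (1 / real n) *
     (\<Sum>i=1..n. ((norm (v + X i))\<^sup>2 + (norm (v - X i))\<^sup>2) / (norm (v - X i) * norm (v + X i)))"

definition regular_update :: "(nat \<Rightarrow> real ^ 'p) \<Rightarrow> nat \<Rightarrow> real ^ 'p \<Rightarrow> real ^ 'p" where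
  "regular_update X n v = (1 / weight X n v) *\<^sub>R (1 / real n) *\<^sub>R
     (\<Sum>i=1..n. (((norm (v + X i))\<^sup>2 - (norm (v - X i))\<^sup>2) / (norm (v - X i) * norm (v + X i))) *\<^sub>R X i)"

definition signed_indices :: "nat \<Rightarrow> int set" where
  "signed_indices n = {- int n..int n} - {0}"

definition signed_sample :: "(nat \<Rightarrow> real ^ 'p) \<Rightarrow> int \<Rightarrow> real ^ 'p" where
  "signed_sample X k = (if k > 0 then X (nat k) else - X (nat (- k)))"

text \<open>With the sign convention used here, this vector is minus the gradient at \<open>X\<^sub>k\<close> of
  \<open>n\<close> times the objective with the \<open>k\<close>-th summand removed; hence the minus sign in the step of
  \<open>sample_update\<close> below gives a descent direction.\<close>

definition sample_grad :: "(nat \<Rightarrow> real ^ 'p) \<Rightarrow> nat \<Rightarrow> int \<Rightarrow> real ^ 'p" where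
  "sample_grad X n k = (\<Sum>i\<in>signed_indices n - {k, - k}.
     (norm (signed_sample X i + signed_sample X k) / norm (signed_sample X i - signed_sample X k))
       *\<^sub>R (signed_sample X i - signed_sample X k))"

definition direction :: "(nat \<Rightarrow> real ^ 'p) \<Rightarrow> nat \<Rightarrow> int \<Rightarrow> real ^ 'p" where
  "direction X n k = - ((1 / norm (sample_grad X n k)) *\<^sub>R sample_grad X n k)"

text \<open>If all sample points vanish, the set below is empty and the bound is unspecified; then
  \<open>sample_grad\<close> is zero and the bound plays no role.\<close>

definition step_bound :: "(nat \<Rightarrow> real ^ 'p) \<Rightarrow> nat \<Rightarrow> real" where
  "step_bound X n = Max ((\<lambda>i. 2 * norm (X i)) ` {1..n} - {0})"

definition sample_update ::
  "(nat \<Rightarrow> real ^ 'p) \<Rightarrow> nat \<Rightarrow> (int \<Rightarrow> real) \<Rightarrow> int \<Rightarrow> real ^ 'p" where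
  "sample_update X n eps k =
     (if norm (sample_grad X n k) - 2 * norm (signed_sample X k) \<le> 0 then signed_sample X k
      else signed_sample X k - eps k *\<^sub>R direction X n k)"

definition admissible_steps :: "(nat \<Rightarrow> real ^ 'p) \<Rightarrow> nat \<Rightarrow> (int \<Rightarrow> real) \<Rightarrow> bool" where
  "admissible_steps X n eps \<longleftrightarrow>
     (\<forall>k\<in>signed_indices n. norm (sample_grad X n k) - 2 * norm (signed_sample X k) > 0 \<longrightarrow>
        0 < eps k \<and> eps k < step_bound X n \<and>
        objective X n (sample_update X n eps k) < objective X n (signed_sample X k))"

definition sample_mean :: "(nat \<Rightarrow> real ^ 'p) \<Rightarrow> nat \<Rightarrow> real ^ 'p" where
  "sample_mean X n = (1 / real n) *\<^sub>R (\<Sum>i=1..n. X i)"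

definition sample_cov :: "(nat \<Rightarrow> real ^ 'p) \<Rightarrow> nat \<Rightarrow> real ^ 'p ^ 'p" where
  "sample_cov X n = (1 / real n) *\<^sub>R
     (\<Sum>i=1..n. \<chi> a b. (X i - sample_mean X n) $ a * (X i - sample_mean X n) $ b)"

definition leading_eigenvector :: "real ^ 'p ^ 'p \<Rightarrow> real ^ 'p \<Rightarrow> bool" where
  "leading_eigenvector A v \<longleftrightarrow> v \<noteq> 0 \<and>
     (\<exists>c. A *v v = c *\<^sub>R v \<and> (\<forall>d w. w \<noteq> 0 \<longrightarrow> A *v w = d *\<^sub>R w \<longrightarrow> d \<le> c))"

text \<open>One pass through the loop body, on states \<open>(v\<^sub>o\<^sub>l\<^sub>d, err)\<close>. For distinct sample points the
  index \<open>k\<close> is determined by \<open>v\<close> unless \<open>v = 0\<close>. In that case \<open>k\<close> and \<open>- k\<close> both qualify, and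
  both give the same result because \<open>sample_grad\<close> is zero for either.\<close>

definition loop_pass ::
  "(nat \<Rightarrow> real ^ 'p) \<Rightarrow> nat \<Rightarrow> (int \<Rightarrow> real) \<Rightarrow> real \<Rightarrow> (real ^ 'p) \<times> real \<Rightarrow> (real ^ 'p) \<times> real" where
  "loop_pass X n eps \<Delta> = (\<lambda>(v, err).
     if \<forall>i\<in>{1..n}. v \<noteq> X i \<and> v \<noteq> - X i
     then (regular_update X n v, objective X n v - objective X n (regular_update X n v))
     else let k = (SOME k. k \<in> signed_indices n \<and> v = signed_sample X k);
              w = sample_update X n eps k
          in (w, if norm (sample_grad X n k) - 2 * norm (signed_sample X k) \<le> 0
                 then objective X n v - objective X n w
                 else \<Delta> + 1))"

text \<open>Admissible step lengths always exist.\<close>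

lemma norm_prod_has_derivative:
  fixes a b u :: "real ^ 'p"
  assumes "a \<noteq> 0" "b \<noteq> 0"
  shows "((\<lambda>t. norm (a - t *\<^sub>R u) * norm (b + t *\<^sub>R u)) has_real_derivative
           ((b \<bullet> u) / norm b * norm a - (a \<bullet> u) / norm a * norm b)) (at 0 within S)"
proof -
  have A: "((\<lambda>t. norm (a - t *\<^sub>R u)) has_derivative (\<lambda>h. h * - ((a \<bullet> u) / norm a))) (at 0 within S)"
    by (rule has_derivative_eq_rhs[OF has_derivative_compose[OF _ has_derivative_norm]])
       (use assms in \<open>auto intro!: derivative_eq_intros simp: sgn_div_norm fun_eq_iff inner_commute field_simps\<close>)
  have B: "((\<lambda>t. norm (b + t *\<^sub>R u)) has_derivative (\<lambda>h. h * ((b \<bullet> u) / norm b))) (at 0 within S)"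
    by (rule has_derivative_eq_rhs[OF has_derivative_compose[OF _ has_derivative_norm]])
       (use assms in \<open>auto intro!: derivative_eq_intros simp: sgn_div_norm fun_eq_iff inner_commute field_simps\<close>)
  show ?thesis
    unfolding has_field_derivative_def
    by (rule has_derivative_eq_rhs[OF has_derivative_mult[OF A B]]) (auto simp: fun_eq_iff algebra_simps)
qed

lemma sum_signed_indices:
  fixes g :: "int \<Rightarrow> 'b::comm_monoid_add"
  assumes "k \<in> signed_indices n"
  shows "(\<Sum>i\<in>signed_indices n - {k, - k}. g i) = (\<Sum>i\<in>{1..n} - {nat \<bar>k\<bar>}. g (int i) + g (- int i))"
proof -
  let ?P = "int ` ({1..n} - {nat \<bar>k\<bar>})" and ?N = "(\<lambda>i. - int i) ` ({1..n} - {nat \<bar>k\<bar>})"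
  have "signed_indices n - {k, - k} \<subseteq> ?P \<union> ?N"
  proof
    fix i assume i: "i \<in> signed_indices n - {k, - k}"
    then have "nat \<bar>i\<bar> \<in> {1..n} - {nat \<bar>k\<bar>}" by (auto simp: signed_indices_def)
    moreover have "i = int (nat \<bar>i\<bar>) \<or> i = - int (nat \<bar>i\<bar>)" by auto
    ultimately show "i \<in> ?P \<union> ?N" by blast
  qed
  moreover have "?P \<union> ?N \<subseteq> signed_indices n - {k, - k}"
    by (auto simp: signed_indices_def)
  ultimately have "signed_indices n - {k, - k} = ?P \<union> ?N" by blast
  moreover have "sum g (?P \<union> ?N) = sum g ?P + sum g ?N" by (intro sum.union_disjoint) auto
  moreover have "sum g ?P = (\<Sum>i\<in>{1..n} - {nat \<bar>k\<bar>}. g (int i))" by (subst sum.reindex) (auto simp: inj_on_def)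
  moreover have "sum g ?N = (\<Sum>i\<in>{1..n} - {nat \<bar>k\<bar>}. g (- int i))" by (subst sum.reindex) (auto simp: inj_on_def)
  ultimately show ?thesis by (simp add: sum.distrib)
qed

lemma admissible_steps_exist:
  fixes X :: "nat \<Rightarrow> real ^ 'p"
  assumes dist: "\<And>i j. i \<in> {1..n} \<Longrightarrow> j \<in> {1..n} \<Longrightarrow> i \<noteq> j \<Longrightarrow> X i \<noteq> X j \<and> X i \<noteq> - X j"
  shows "\<exists>eps. admissible_steps X n eps"
proof -
  have "\<exists>e. 0 < e \<and> e < step_bound X n \<and>
          objective X n (signed_sample X k - e *\<^sub>R direction X n k) < objective X n (signed_sample X k)"
    if k: "k \<in> signed_indices n" and gt: "norm (sample_grad X n k) - 2 * norm (signed_sample X k) > 0" for k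
  proof -
    define m where "m = nat \<bar>k\<bar>"
    define x where "x = signed_sample X k"
    define G where "G = sample_grad X n k"
    define u where "u = (1 / norm G) *\<^sub>R G"
    define h where "h i t = norm (X i - (x + t *\<^sub>R u)) * norm (X i + (x + t *\<^sub>R u))" for i t
    have m: "m \<in> {1..n}" using k by (auto simp: m_def signed_indices_def)
    have xm: "x = X m \<or> x = - X m" by (auto simp: x_def m_def signed_sample_def)
    have "norm G > 0" using gt norm_ge_zero[of "signed_sample X k"] unfolding G_def by linarith
    then have G0: "G \<noteq> 0" by auto
    then have Gu: "G \<bullet> u = norm G" and nu: "norm u = 1"
      by (auto simp: u_def dot_square_norm power2_eq_square)
    have x_ne: "X i \<noteq> x \<and> X i \<noteq> - x" if "i \<in> {1..n} - {m}" for i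
      using dist[of i m] that m xm by auto
    define D where "D i = ((X i + x) \<bullet> u) / norm (X i + x) * norm (X i - x)
        - ((X i - x) \<bullet> u) / norm (X i - x) * norm (X i + x)" for i
    have Dh: "(h i has_real_derivative D i) (at 0 within {0..})" if "i \<in> {1..n} - {m}" for i
    proof -
      have "X i - x \<noteq> 0" "X i + x \<noteq> 0" using x_ne[OF that] by (auto simp: eq_neg_iff_add_eq_0)
      from norm_prod_has_derivative[OF this, of u "{0..}"] show ?thesis
        unfolding D_def h_def by (simp add: algebra_simps)
    qed
    have sumD: "(\<Sum>i\<in>{1..n} - {m}. D i) = - norm G"
    proof -
      have "G = (\<Sum>i\<in>{1..n} - {m}.
          (norm (X i + x) / norm (X i - x)) *\<^sub>R (X i - x) + (norm (- X i + x) / norm (- X i - x)) *\<^sub>R (- X i - x))"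
        unfolding G_def sample_grad_def sum_signed_indices[OF k] m_def[symmetric] x_def[symmetric]
        by (rule sum.cong) (auto simp: signed_sample_def)
      then have "G \<bullet> u = (\<Sum>i\<in>{1..n} - {m}.
          ((norm (X i + x) / norm (X i - x)) *\<^sub>R (X i - x) + (norm (- X i + x) / norm (- X i - x)) *\<^sub>R (- X i - x)) \<bullet> u)"
        by (simp add: inner_sum_left)
      also have "\<dots> = (\<Sum>i\<in>{1..n} - {m}. - D i)"
      proof (rule sum.cong)
        fix i
        have "norm (- X i + x) = norm (X i - x)" "norm (- X i - x) = norm (X i + x)" "- X i - x = - (X i + x)"
          by (metis minus_diff_eq norm_minus_cancel uminus_add_conv_diff,
              metis minus_add_distrib norm_minus_cancel uminus_add_conv_diff diff_conv_add_uminus, simp)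
        then show "((norm (X i + x) / norm (X i - x)) *\<^sub>R (X i - x) + (norm (- X i + x) / norm (- X i - x)) *\<^sub>R (- X i - x)) \<bullet> u = - D i"
          unfolding D_def by (simp only: inner_add_left inner_scaleR_left inner_minus_left) (simp add: field_simps flip: add_divide_distrib)
      qed simp
      finally show ?thesis using Gu by (simp add: sum_negf)
    qed
    have hm: "h m t = t * norm (2 *\<^sub>R x + t *\<^sub>R u)" if "t \<ge> 0" for t
    proof -
      have "norm (X m - (x + t *\<^sub>R u)) * norm (X m + (x + t *\<^sub>R u)) = norm (t *\<^sub>R u) * norm (2 *\<^sub>R x + t *\<^sub>R u)"
        using xm
      proof
        assume "x = X m"
        then show ?thesis by (simp add: scaleR_2 add.assoc)
      next
        assume "x = - X m"
        then have "X m = - x" by simp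
        moreover have "- x - (x + t *\<^sub>R u) = - (2 *\<^sub>R x + t *\<^sub>R u)" by (simp add: scaleR_2)
        ultimately show ?thesis by (simp only: norm_minus_cancel) simp
      qed
      then show ?thesis using that nu by (simp add: h_def)
    qed
    have Dm: "(h m has_real_derivative 2 * norm x) (at 0 within {0..})"
    proof -
      have "((\<lambda>t. norm (2 *\<^sub>R x + t *\<^sub>R u)) \<longlongrightarrow> norm (2 *\<^sub>R x + 0 *\<^sub>R u)) (at 0 within {0..})"
        by (intro tendsto_intros)
      then have "((\<lambda>t. (h m t - h m 0) / (t - 0)) \<longlongrightarrow> 2 * norm x) (at 0 within {0..})"
        by (rule tendsto_cong[THEN iffD1, rotated, OF tendsto_eq_rhs])
           (auto simp: hm eventually_at_filter)
      then show ?thesis by (simp add: has_field_derivative_iff)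
    qed
    have "((\<lambda>t. \<Sum>i\<in>{1..n}. h i t) has_real_derivative (2 * norm x - norm G)) (at 0 within {0..})"
    proof -
      have "((\<lambda>t. h m t + (\<Sum>i\<in>{1..n} - {m}. h i t)) has_real_derivative
              (2 * norm x + (\<Sum>i\<in>{1..n} - {m}. D i))) (at 0 within {0..})"
        by (intro DERIV_add Dm DERIV_sum Dh)
      moreover have "(\<lambda>t. h m t + (\<Sum>i\<in>{1..n} - {m}. h i t)) = (\<lambda>t. \<Sum>i\<in>{1..n}. h i t)"
        using m by (simp add: sum.remove[of _ m])
      ultimately show ?thesis using sumD by simp
    qed
    from has_real_derivative_neg_dec_right[OF this] gt obtain d where d: "d > 0"
      and dd: "\<And>t. 0 < t \<Longrightarrow> t < d \<Longrightarrow> (\<Sum>i\<in>{1..n}. h i t) < (\<Sum>i\<in>{1..n}. h i 0)"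
      by (auto simp: G_def x_def)
    have M: "step_bound X n > 0"
    proof -
      have "(\<lambda>i. 2 * norm (X i)) ` {1..n} - {0} \<noteq> {}"
      proof
        assume "(\<lambda>i. 2 * norm (X i)) ` {1..n} - {0} = {}"
        then have z: "X i = 0" if "i \<in> {1..n}" for i using that by (fastforce simp del: atLeastAtMost_iff)
        have "signed_sample X i = 0" if "i \<in> signed_indices n" for i
        proof -
          have "nat \<bar>i\<bar> \<in> {1..n}" using that by (auto simp: signed_indices_def)
          from z[OF this] show ?thesis by (auto simp: signed_sample_def)
        qed
        then have "G = 0" using k unfolding G_def sample_grad_def by (intro sum.neutral) auto
        then show False using G0 by simp
      qed
      then have "step_bound X n \<in> (\<lambda>i. 2 * norm (X i)) ` {1..n} - {0}"
        unfolding step_bound_def by (intro Max_in) auto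
      then show ?thesis by auto
    qed
    define e where "e = min d (step_bound X n) / 2"
    have e: "0 < e" "e < d" "e < step_bound X n" using d M by (auto simp: e_def min_def)
    have "signed_sample X k - e *\<^sub>R direction X n k = x + e *\<^sub>R u"
      by (simp add: direction_def x_def u_def G_def)
    moreover have "objective X n (x + e *\<^sub>R u) < objective X n x"
    proof -
      have "objective X n (x + t *\<^sub>R u) = (1 / real n) * ((\<Sum>i\<in>{1..n}. h i t) - (\<Sum>i\<in>{1..n}. (norm (X i))\<^sup>2))" for t
        unfolding objective_def h_def by (simp add: sum_subtractf)
      from this[of e] this[of 0] dd[OF e(1,2)] m show ?thesis by (simp add: divide_strict_right_mono)
    qed
    ultimately show ?thesis using e unfolding x_def by metis
  qed
  then obtain eps where "\<And>k. k \<in> signed_indices n \<Longrightarrow> norm (sample_grad X n k) - 2 * norm (signed_sample X k) > 0 \<Longrightarrow>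
      0 < eps k \<and> eps k < step_bound X n \<and>
          objective X n (signed_sample X k - eps k *\<^sub>R direction X n k) < objective X n (signed_sample X k)"
    by metis
  then have "admissible_steps X n eps" unfolding admissible_steps_def sample_update_def by auto
  then show ?thesis by blast
qed

end

theory Submission
  imports Defs
begin

text \<open>Every pass that does not end the loop strictly decreases the objective: a regular pass by
  more than \<open>\<Delta>\<close> (otherwise the loop test fails), a pass at a sample point by the choice of the step
  length. The objective is bounded below, so there are finitely many regular passes, and no sample
  point is left twice.\<close>

text \<open>Products of norms are nonnegative. The bound keeps the floor in \<open>potential\<close>
  from being truncated by \<open>nat\<close>.\<close>

lemma objective_lower_bound: "- (1 / real n) * (\<Sum>i=1..n. (norm (X i))\<^sup>2) \<le> objective X n v"
proof -
  have "(1 / real n) * (\<Sum>i=1..n. - (norm (X i))\<^sup>2) \<le> objective X n v"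
    unfolding objective_def by (intro mult_left_mono sum_mono) auto
  then show ?thesis by (simp add: sum_negf)
qed

text \<open>Guarantees a witness for the \<open>SOME\<close> in \<open>loop_pass\<close>.\<close>

lemma sample_point_eq_signed_sample:
  assumes "\<not> (\<forall>i\<in>{1..n}. v \<noteq> X i \<and> v \<noteq> - X i)"
  shows "\<exists>k. k \<in> signed_indices n \<and> v = signed_sample X k"
proof -
  from assms obtain i where i: "i \<in> {1..n}" "v = X i \<or> v = - X i" by blast
  have "int i \<in> signed_indices n" "- int i \<in> signed_indices n"
    using i(1) by (auto simp: signed_indices_def)
  moreover have "signed_sample X (int i) = X i" "signed_sample X (- int i) = - X i"
    using i(1) by (auto simp: signed_sample_def)
  ultimately show ?thesis using i(2) by metis
qed

text \<open>At a regular point \<open>err'\<close> is the decrease itself. At a sample point the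
  decrease may be arbitrarily small, so the second alternative also records where it
  started.\<close>

lemma loop_pass_descent:
  assumes "\<Delta> > 0" "admissible_steps X n eps"
    and "loop_pass X n eps \<Delta> (v, err) = (w, err')" "err' > \<Delta>"
  shows "objective X n w < objective X n v - \<Delta> \<or>
    objective X n w < objective X n v \<and> (\<exists>k\<in>signed_indices n. v = signed_sample X k)"
proof (cases "\<forall>i\<in>{1..n}. v \<noteq> X i \<and> v \<noteq> - X i")
  case True
  then show ?thesis using assms(3,4) by (auto simp: loop_pass_def)
next
  case False
  define k where "k = (SOME k. k \<in> signed_indices n \<and> v = signed_sample X k)"
  have k: "k \<in> signed_indices n" "v = signed_sample X k"
    using someI_ex[OF sample_point_eq_signed_sample[OF False]] unfolding k_def by blast+
  have "loop_pass X n eps \<Delta> (v, err) = (sample_update X n eps k,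
      if norm (sample_grad X n k) - 2 * norm (signed_sample X k) \<le> 0
      then objective X n v - objective X n (sample_update X n eps k) else \<Delta> + 1)"
    by (simp only: loop_pass_def prod.case False if_False Let_def k_def)
  then have w: "w = sample_update X n eps k"
    and e: "err' = (if norm (sample_grad X n k) - 2 * norm (signed_sample X k) \<le> 0
                    then objective X n v - objective X n w else \<Delta> + 1)"
    unfolding assms(3) prod.inject by (simp_all only:)
  \<comment> \<open>Otherwise the iterate stays put and \<open>err' = 0\<close>, which fails the
    loop test.\<close>
  have "norm (sample_grad X n k) - 2 * norm (signed_sample X k) > 0"
  proof (rule ccontr)
    assume "\<not> ?thesis"
    then have "w = v" "err' = objective X n v - objective X n w"
      using w e k(2) by (auto simp: sample_update_def)
    then show False using assms(1,4) by simp
  qed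
  then have "objective X n w < objective X n v"
    using assms(2) k w unfolding admissible_steps_def by blast
  then show ?thesis using k by blast
qed

text \<open>The first summand is the height above the lower bound in whole units of
  \<open>\<Delta>\<close>; the second counts the signed indices whose sample values are still at or
  below the current level.\<close>

definition potential :: "(nat \<Rightarrow> real ^ 'p) \<Rightarrow> nat \<Rightarrow> real \<Rightarrow> real ^ 'p \<Rightarrow> nat" where
  "potential X n \<Delta> v =
     nat \<lfloor>(objective X n v + (1 / real n) * (\<Sum>i=1..n. (norm (X i))\<^sup>2)) / \<Delta>\<rfloor> +
     card {k \<in> signed_indices n. objective X n (signed_sample X k) \<le> objective X n v}"

text \<open>Neither summand grows when the objective falls, so a plain sum works: the first
  alternative lowers the floor, the second the count.\<close>

lemma potential_less:
  assumes "\<Delta> > 0"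
    and "objective X n w < objective X n v - \<Delta> \<or>
      objective X n w < objective X n v \<and> (\<exists>k\<in>signed_indices n. v = signed_sample X k)"
  shows "potential X n \<Delta> w < potential X n \<Delta> v"
proof -
  define B where "B = (1 / real n) * (\<Sum>i=1..n. (norm (X i))\<^sup>2)"
  define S where "S u = {k \<in> signed_indices n. objective X n (signed_sample X k) \<le> objective X n u}" for u
  define q where "q u = (objective X n u + B) / \<Delta>" for u
  have pot: "potential X n \<Delta> u = nat \<lfloor>q u\<rfloor> + card (S u)" for u
    by (simp add: potential_def B_def S_def q_def)
  have fin: "finite (S u)" for u
    unfolding S_def signed_indices_def by (rule finite_subset[of _ "{- int n..int n}"]) auto
  have "objective X n w < objective X n v" using assms by auto
  then have sub: "S w \<subseteq> S v" and q_le: "q w \<le> q v"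
    using assms(1) by (auto simp: S_def q_def divide_le_cancel)
  have card_le: "card (S w) \<le> card (S v)" using sub fin by (rule card_mono[rotated])
  from assms(2) show ?thesis
  proof
    assume "objective X n w < objective X n v - \<Delta>"
    then have "(objective X n w + B + \<Delta>) / \<Delta> \<le> q v"
      using assms(1) unfolding q_def by (intro divide_right_mono) auto
    then have "q w + 1 \<le> q v" using assms(1) by (simp add: q_def add_divide_distrib)
    then have "\<lfloor>q w\<rfloor> + 1 \<le> \<lfloor>q v\<rfloor>" by linarith
    \<comment> \<open>For a negative floor, \<open>nat\<close> would hide the drop by one.\<close>
    moreover have "0 \<le> \<lfloor>q w\<rfloor>"
      using objective_lower_bound[of n X w] assms(1) by (simp add: q_def B_def)
    ultimately show ?thesis using card_le unfolding pot by linarith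
  next
    assume a: "objective X n w < objective X n v \<and> (\<exists>k\<in>signed_indices n. v = signed_sample X k)"
    then obtain k where "k \<in> signed_indices n" "v = signed_sample X k" by blast
    \<comment> \<open>The index \<open>k\<close> attains the level of \<open>v\<close> exactly, so
      any strict decrease removes it from the count.\<close>
    then have "k \<in> S v" "k \<notin> S w" using a by (auto simp: S_def)
    then have "card (S w) < card (S v)" using sub fin by (intro psubset_card_mono) auto
    moreover have "nat \<lfloor>q w\<rfloor> \<le> nat \<lfloor>q v\<rfloor>" using q_le by (intro nat_mono floor_mono)
    ultimately show ?thesis unfolding pot by linarith
  qed
qed

theorem corollary2:
  fixes X :: "nat \<Rightarrow> real ^ 'p" and n :: nat and \<Delta> :: real
    and eps :: "int \<Rightarrow> real" and v0 :: "real ^ 'p"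
  assumes "n \<ge> 1"
    and "\<And>i j. i \<in> {1..n} \<Longrightarrow> j \<in> {1..n} \<Longrightarrow> i \<noteq> j \<Longrightarrow> X i \<noteq> X j \<and> X i \<noteq> - X j"
    and "\<Delta> > 0"
    and "admissible_steps X n eps"
    and "leading_eigenvector (sample_cov X n) v0" and "norm v0 = 1"
  shows "\<exists>s. while_option (\<lambda>(v, err). err > \<Delta>) (loop_pass X n eps \<Delta>) (v0, \<Delta> + 1) = Some s"
proof -
  \<comment> \<open>The pass that ends the loop need not decrease the potential, hence the value 0 on final states.\<close>
  define m where "m = (\<lambda>(v, err). if err > \<Delta> then Suc (potential X n \<Delta> v) else 0)"
  have "m (loop_pass X n eps \<Delta> s) < m s" if "(\<lambda>(v, err). err > \<Delta>) s" for s
  proof -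
    obtain v err where s: "s = (v, err)" by force
    obtain w err' where p: "loop_pass X n eps \<Delta> (v, err) = (w, err')" by force
    show ?thesis
      using that potential_less[OF assms(3) loop_pass_descent[OF assms(3,4) p]]
      by (simp add: m_def s p)
  qed
  then show ?thesis
    \<comment> \<open>The measure falls from every state that passes the loop test, so the trivial
      invariant suffices.\<close>
    by (intro measure_while_option_Some[where P = "\<lambda>_. True" and f = m]) auto
qed

end
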